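(* Let $\mathcal{A}$ be a finite subgroup of $SU(3)$ which consists of diagonal matrices and satisfies $E\mathcal{A}E^{-1}=\mathcal{A}$, where $E=\begin{pmatrix}0&1&0\\0&0&1\\1&0&0\end{pmatrix}$. Then there are positive integers $m$ and $n$, with $n$ a divisor of $m$, such that $$\mathcal{A}\cong \mathbb{Z}_m\times\mathbb{Z}_n .$$ Furthermore, the cyclic groups $\mathbb{Z}_m$ and $\mathbb{Z}_n$ in this decomposition are generated by matrices $F\in\mathcal{A}$ and $G\in\mathcal{A}$, respectively (so that $\mathcal{A}$ is the internal direct product of $\langle F\rangle\cong\mathbb{Z}_m$ and $\langle G\rangle\cong\mathbb{Z}_n$), which have the form $$F=\mathrm{diag}\left(\epsilon,\ \epsilon^{k},\ \epsilon^{-k-1}\right),\qquad G=\mathrm{diag}\left(1,\ \epsilon^{-r},\ \epsilon^{r}\right),$$ with $\epsilon=\exp(2\pi i/m)$, $r=m/n$ and some $k\in\{0,1,\ldots,r-1\}$.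
   Context: $\mathbb{Z}_j$ denotes the cyclic group of order $j$. *)

theory Defs
  imports "HOL-Analysis.Analysis" "HOL-Algebra.Elementary_Groups"
begin

definition conj_transpose :: "complex ^ 'n ^ 'm \<Rightarrow> complex ^ 'm ^ 'n" where
  "conj_transpose U = (\<chi> i j. cnj (U $ j $ i))"

definition unitary_matrix :: "complex ^ 'n ^ 'n \<Rightarrow> bool" where
  "unitary_matrix U \<longleftrightarrow>
     conj_transpose U ** U = mat 1 \<and> U ** conj_transpose U = mat 1"

definition SU :: "(complex ^ 'n ^ 'n) monoid" where
  "SU = \<lparr>carrier = {U. unitary_matrix U \<and> det U = 1}, monoid.mult = (**), one = mat 1\<rparr>"

abbreviation SU3 :: "(complex ^ 3 ^ 3) monoid" where
  "SU3 \<equiv> SU"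

definition diagonal_matrix :: "'a::zero ^ 'n ^ 'n \<Rightarrow> bool" where
  "diagonal_matrix A \<longleftrightarrow> (\<forall>i j. i \<noteq> j \<longrightarrow> A $ i $ j = 0)"

definition diag3 :: "'a::zero \<Rightarrow> 'a \<Rightarrow> 'a \<Rightarrow> 'a ^ 3 ^ 3" where
  "diag3 a b c = vector [vector [a, 0, 0], vector [0, b, 0], vector [0, 0, c]]"

definition perm_E :: "complex ^ 3 ^ 3" where
  "perm_E = vector [vector [0, 1, 0], vector [0, 0, 1], vector [1, 0, 0]]"

definition internal_direct_product ::
    "('a, 'b) monoid_scheme \<Rightarrow> 'a set \<Rightarrow> 'a set \<Rightarrow> bool" where
  "internal_direct_product G H K \<longleftrightarrow>
     H \<lhd> G \<and> K \<lhd> G \<and> H \<inter> K = {\<one>\<^bsub>G\<^esub>} \<and> H <#>\<^bsub>G\<^esub> K = carrier G"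

lemma conj_transpose_mult: "conj_transpose (A ** B) = conj_transpose B ** conj_transpose A"
  by (simp add: conj_transpose_def matrix_matrix_mult_def vec_eq_iff mult.commute)

lemma conj_transpose_conj_transpose [simp]: "conj_transpose (conj_transpose A) = A"
  by (simp add: conj_transpose_def vec_eq_iff)

lemma conj_transpose_mat_1 [simp]: "conj_transpose (mat 1) = mat 1"
  by (auto simp: conj_transpose_def mat_def vec_eq_iff)

lemma unitary_matrix_mult:
  assumes "unitary_matrix A" "unitary_matrix B"
  shows "unitary_matrix (A ** B)"
  using assms unfolding unitary_matrix_def conj_transpose_mult
  by (metis matrix_mul_assoc matrix_mul_rid)

lemma group_SU: "group (SU :: (complex ^ 'n ^ 'n) monoid)"
proof (rule groupI)
  fix x :: "complex ^ 'n ^ 'n"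
  assume x: "x \<in> carrier SU"
  then have u: "conj_transpose x ** x = mat 1" "x ** conj_transpose x = mat 1" "det x = 1"
    by (auto simp: SU_def unitary_matrix_def)
  have "det (conj_transpose x) = 1"
    using u by (metis det_I det_mul mult.right_neutral)
  with u have "conj_transpose x \<in> carrier SU"
    by (simp add: SU_def unitary_matrix_def)
  with u show "\<exists>y\<in>carrier SU. y \<otimes>\<^bsub>SU\<^esub> x = \<one>\<^bsub>SU\<^esub>"
    by (auto simp: SU_def)
next
  show "\<one>\<^bsub>SU\<^esub> \<in> carrier (SU :: (complex ^ 'n ^ 'n) monoid)"
    by (simp add: SU_def unitary_matrix_def)
qed (simp_all add: SU_def unitary_matrix_mult det_mul matrix_mul_assoc)

end

theory Submission
  imports Defs "HOL-Algebra.Multiplicative_Group"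
begin

text \<open>Conjugation by \<^term>\<open>perm_E\<close> cyclically permutes the diagonal entries, so every entry
  of a matrix in \<open>A\<close> lies in the group \<open>H\<close> of first entries, which is finite and hence
  the group of \<open>m\<close>-th roots of unity. The matrices in \<open>A\<close> with first entry 1 have the form
  \<open>diag(1, 1/c, c)\<close> with \<open>c\<close> in a subgroup of \<open>H\<close>, the group of \<open>n\<close>-th roots of unity.
  A matrix \<open>F\<close> in \<open>A\<close> whose first entry is a primitive \<open>m\<close>-th root of unity has order \<open>m\<close>,
  because its other entries are \<open>m\<close>-th roots of unity too, and so \<open>F\<close> splits the projection
  to the first entry.\<close>

section \<open>Cyclic groups and direct products\<close>

text \<open>The isomorphism is \<open>i\<close> to \<open>a [^] i\<close>, which depends only on
  \<open>i\<close> modulo \<open>ord a\<close>. Infinite order is included: then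
  \<open>ord a = 0\<close>, reduction mod 0 is the identity, and \<open>integer_mod_group 0\<close>
  is the group of integers.\<close>

lemma (in group) generate_singleton_iso:
  assumes a: "a \<in> carrier G"
  shows "G\<lparr>carrier := generate G {a}\<rparr> \<cong> integer_mod_group (ord a)"
proof -
  let ?C = "G\<lparr>carrier := generate G {a}\<rparr>"
  have pow: "a [^] (i mod int (ord a)) = a [^] i" for i :: int
    using int_pow_eq[OF a] by (simp add: dvd_minus_mod)
  have "(\<lambda>i::int. a [^] i) \<in> iso (integer_mod_group (ord a)) ?C"
    unfolding iso_def
  proof (intro CollectI conjI homI)
    show "bij_betw (\<lambda>i::int. a [^] i) (carrier (integer_mod_group (ord a))) (carrier ?C)"
      unfolding bij_betw_def
    proof
      show "inj_on (\<lambda>i::int. a [^] i) (carrier (integer_mod_group (ord a)))"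
      proof (rule inj_onI)
        fix i j :: int
        assume ij: "i \<in> carrier (integer_mod_group (ord a))" "j \<in> carrier (integer_mod_group (ord a))"
          and "a [^] i = a [^] j"
        then have "j mod int (ord a) = i mod int (ord a)"
          using int_pow_eq[OF a, of i j] by (simp add: mod_eq_dvd_iff)
        with ij show "i = j"
          by (auto simp: carrier_integer_mod_group split: if_splits)
      qed
      have "(\<lambda>i::int. a [^] i) ` carrier (integer_mod_group (ord a)) = range (\<lambda>i::int. a [^] i)"
      proof (intro equalityI subsetI)
        fix x assume "x \<in> range (\<lambda>i::int. a [^] i)"
        then obtain i :: int where "x = a [^] (i mod int (ord a))"
          using pow by auto
        moreover have "i mod int (ord a) \<in> carrier (integer_mod_group (ord a))"
          by (simp add: carrier_integer_mod_group)
        ultimately show "x \<in> (\<lambda>i::int. a [^] i) ` carrier (integer_mod_group (ord a))"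
          by blast
      qed auto
      then show "(\<lambda>i::int. a [^] i) ` carrier (integer_mod_group (ord a)) = carrier ?C"
        by (auto simp: generate_pow[OF a])
    qed
  qed (use a in \<open>auto simp: generate_pow[OF a] pow int_pow_mult\<close>)
  then have "integer_mod_group (ord a) \<cong> ?C"
    by (auto simp: is_iso_def)
  then show ?thesis
    by (rule group.iso_sym[OF group_integer_mod_group])
qed

lemma (in group) internal_direct_product_iso:
  assumes "internal_direct_product G H K"
  shows "G\<lparr>carrier := H\<rparr> \<times>\<times> G\<lparr>carrier := K\<rparr> \<cong> G"
proof -
  have *: "H \<lhd> G" "K \<lhd> G" "H \<inter> K \<subseteq> {\<one>}" "H <#> K = carrier G"
    using assms by (auto simp: internal_direct_product_def)
  then interpret group_disjoint_sum G H K
    by (auto simp: group_disjoint_sum_def normal_def)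
  \<comment> \<open>A subgroup is its own generated closure, so the isomorphism
    \<open>iso_group_mul_gen\<close>, phrased with \<open>subgroup_generated\<close>, carries over
    to restricted carriers.\<close>
  have eq: "subgroup_generated G L = G\<lparr>carrier := L\<rparr>" if "subgroup L G" for L
  proof -
    have "generate G L = L"
      using generate_subgroup_incl[OF subset_refl that] by (auto intro: generate.incl)
    then show ?thesis
      using subgroup.subset[OF that] by (simp add: subgroup_generated_def Int_absorb1)
  qed
  show ?thesis
    using iso_group_mul_gen[OF *(1,2)] *(3,4) unfolding eq[OF AG.subgroup_axioms] eq[OF BG.subgroup_axioms] is_iso_def by blast
qed

section \<open>Finite groups of complex numbers\<close>

text \<open>Multiplication by \<open>h\<close> permutes the finite set \<open>H\<close>, so the
  product of all elements is multiplied by \<open>h ^ card H\<close> and yet unchanged; being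
  nonzero, it cancels. Hence \<open>H\<close> consists of \<open>card H\<close>-th roots of unity,
  and there are exactly \<open>card H\<close> of these.\<close>

lemma finite_mult_closed_eq_roots_unity:
  fixes H :: "complex set"
  assumes "finite H" "0 \<notin> H" "H \<noteq> {}" and closed: "\<And>x y. x \<in> H \<Longrightarrow> y \<in> H \<Longrightarrow> x * y \<in> H"
  shows "H = {z. z ^ card H = 1}"
proof (rule card_subset_eq)
  have card: "card H > 0"
    using assms by (simp add: card_gt_0_iff)
  then show "finite {z::complex. z ^ card H = 1}"
    by (intro finite_roots_unity) simp
  show "card H = card {z::complex. z ^ card H = 1}"
    using card_roots_unity_eq[OF card] by simp
  show "H \<subseteq> {z. z ^ card H = 1}"
  proof
    fix h assume h: "h \<in> H"
    have inj: "inj_on ((*) h) H"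
      using h \<open>0 \<notin> H\<close> by (auto simp: inj_on_def)
    have "(*) h ` H = H"
      by (rule endo_inj_surj) (use assms h inj in auto)
    then have "\<Prod>H = (\<Prod>x\<in>H. h * x)"
      using prod.reindex[OF inj, of id] by simp
    also have "\<dots> = h ^ card H * \<Prod>H"
      by (simp add: prod.distrib)
    finally show "h \<in> {z. z ^ card H = 1}"
      using \<open>0 \<notin> H\<close> \<open>finite H\<close> by simp
  qed
qed

lemma exp_root_unity_power_eq_1_iff:
  assumes "m > 0"
  shows "exp (2 * of_real pi * \<i> / of_nat m) ^ j = (1::complex) \<longleftrightarrow> m dvd j"
  using complex_root_unity_eq_1[of m j] assms
  by (simp flip: exp_of_nat_mult add: mult_ac)

lemma root_unity_eq_exp_power:
  assumes "m > 0" "(z::complex) ^ m = 1"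
  obtains j where "z = exp (2 * of_real pi * \<i> / of_nat m) ^ j"
proof -
  have "z \<in> {z. z ^ m = 1}"
    using assms by simp
  then obtain j :: nat where "z = exp (2 * of_real pi * \<i> * of_nat j / of_nat m)"
    using complex_roots_unity[of m] assms(1) by auto
  then show ?thesis
    by (intro that[of j]) (simp flip: exp_of_nat_mult add: mult_ac)
qed

section \<open>Diagonal matrices\<close>

lemma diag3_nth [simp]:
  "diag3 a b c $ 1 $ 1 = a" "diag3 a b c $ 1 $ 2 = 0" "diag3 a b c $ 1 $ 3 = 0"
  "diag3 a b c $ 2 $ 1 = 0" "diag3 a b c $ 2 $ 2 = b" "diag3 a b c $ 2 $ 3 = 0"
  "diag3 a b c $ 3 $ 1 = 0" "diag3 a b c $ 3 $ 2 = 0" "diag3 a b c $ 3 $ 3 = c"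
  by (simp_all add: diag3_def)

lemma diag3_eq_iff [simp]: "diag3 a b c = diag3 a' b' c' \<longleftrightarrow> a = a' \<and> b = b' \<and> c = c'"
  by (auto simp: vec_eq_iff forall_3)

lemma diag3_mult [simp]:
  "diag3 a b c ** diag3 a' b' c' = diag3 (a * a' :: 'a::semiring_1) (b * b') (c * c')"
  by (simp add: vec_eq_iff forall_3 matrix_matrix_mult_def sum_3)

lemma mat_1_eq_diag3: "mat 1 = diag3 1 1 (1::'a::zero_neq_one)"
  by (simp add: vec_eq_iff forall_3 mat_def)

lemma det_diag3 [simp]: "det (diag3 a b c) = a * b * (c::'a::comm_ring_1)"
  by (simp add: det_3)

lemma diagonal_matrix_eq_diag3:
  "diagonal_matrix M \<Longrightarrow> M = diag3 (M $ 1 $ 1) (M $ 2 $ 2) (M $ 3 $ 3)"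
  by (simp add: diagonal_matrix_def vec_eq_iff forall_3)

lemma perm_E_conj_diag3: "perm_E ** diag3 a b c ** matrix_inv perm_E = diag3 b c a"
proof -
  have "det perm_E = 1"
    by (simp add: det_3 perm_E_def)
  then have "invertible perm_E"
    by (simp add: invertible_det_nz)
  \<comment> \<open>\<open>matrix_inv\<close> is a choice of a two-sided inverse, so invertibility
    is what makes the chosen matrix one.\<close>
  then have inv: "perm_E ** matrix_inv perm_E = mat 1"
    using someI_ex[of "\<lambda>B. perm_E ** B = mat 1 \<and> B ** perm_E = mat 1"]
    by (simp add: matrix_inv_def invertible_def)
  have "perm_E ** diag3 a b c = diag3 b c a ** perm_E"
    by (simp add: vec_eq_iff forall_3 matrix_matrix_mult_def sum_3 perm_E_def)
  with inv show ?thesis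
    by (metis matrix_mul_assoc matrix_mul_rid)
qed

lemma diag3_nat_pow:
  "diag3 a b c [^]\<^bsub>SU3\<lparr>carrier := A\<rparr>\<^esub> (n::nat) = diag3 (a ^ n) (b ^ n) (c ^ n)"
  by (induction n) (simp_all add: SU_def mat_1_eq_diag3 nat_pow_def mult_ac)

text \<open>Commutativity later makes every subgroup of \<open>A\<close> normal, as
  \<open>internal_direct_product\<close> demands.\<close>

lemma comm_group_diagonal_subgroup:
  assumes "subgroup A SU3" "\<forall>M\<in>A. diagonal_matrix M"
  shows "comm_group (SU3\<lparr>carrier := A\<rparr>)"
proof (rule group.group_comm_groupI)
  show "group (SU3\<lparr>carrier := A\<rparr>)"
    by (rule subgroup.subgroup_is_group[OF assms(1) group_SU])
  fix x y assume "x \<in> carrier (SU3\<lparr>carrier := A\<rparr>)" "y \<in> carrier (SU3\<lparr>carrier := A\<rparr>)"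
  then obtain a b c a' b' c' where "x = diag3 a b c" "y = diag3 a' b' c'"
    using assms(2) diagonal_matrix_eq_diag3[of x] diagonal_matrix_eq_diag3[of y] by auto
  then show "x \<otimes>\<^bsub>SU3\<lparr>carrier := A\<rparr>\<^esub> y = y \<otimes>\<^bsub>SU3\<lparr>carrier := A\<rparr>\<^esub> x"
    by (simp add: SU_def mult.commute)
qed

theorem theorem1:
  fixes A :: "(complex ^ 3 ^ 3) set"
  assumes "subgroup A SU3"
    and "finite A"
    and "\<forall>M\<in>A. diagonal_matrix M"
    and "(\<lambda>M. perm_E ** M ** matrix_inv perm_E) ` A = A"
  shows "\<exists>m n :: nat. m > 0 \<and> n > 0 \<and> n dvd m \<and>
    SU3\<lparr>carrier := A\<rparr> \<cong> integer_mod_group m \<times>\<times> integer_mod_group n \<and>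
    (\<exists>F\<in>A. \<exists>G\<in>A.
       SU3\<lparr>carrier := generate SU3 {F}\<rparr> \<cong> integer_mod_group m \<and>
       SU3\<lparr>carrier := generate SU3 {G}\<rparr> \<cong> integer_mod_group n \<and>
       internal_direct_product (SU3\<lparr>carrier := A\<rparr>) (generate SU3 {F}) (generate SU3 {G}) \<and>
       (let \<epsilon> = exp (2 * of_real pi * \<i> / of_nat m); r = m div n in
          (\<exists>k\<in>{0..<r}. F = diag3 \<epsilon> (\<epsilon> ^ k) (\<epsilon> powi (- int k - 1))) \<and>
          G = diag3 1 (\<epsilon> powi (- int r)) (\<epsilon> powi (int r))))"
proof -
  let ?G = "SU3\<lparr>carrier := A\<rparr>"
  interpret comm_group ?G
    by (rule comm_group_diagonal_subgroup) fact+
  have diag: "\<exists>a b c. M = diag3 a b c \<and> a * b * c = 1" if "M \<in> A" for M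
  proof -
    have "M = diag3 (M $ 1 $ 1) (M $ 2 $ 2) (M $ 3 $ 3)" "det M = 1"
      using assms that diagonal_matrix_eq_diag3 subgroup.subset[OF assms(1)] by (auto simp: SU_def)
    then show ?thesis
      by (metis det_diag3)
  qed
  have det: "a * b * c = 1" if "diag3 a b c \<in> A" for a b c
    using diag[OF that] by auto
  have mult: "diag3 (a * a') (b * b') (c * c') \<in> A"
    if "diag3 a b c \<in> A" "diag3 a' b' c' \<in> A" for a b c a' b' c'
    using m_closed[of "diag3 a b c" "diag3 a' b' c'"] that by (simp add: SU_def)
  have one: "diag3 1 1 1 \<in> A"
    using one_closed by (simp add: SU_def mat_1_eq_diag3)
  have pow: "diag3 (a ^ j) (b ^ j) (c ^ j) \<in> A" if "diag3 a b c \<in> A" for a b c and j :: nat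
    using nat_pow_closed[of "diag3 a b c" j] that by (simp add: diag3_nat_pow)
  have shift: "diag3 b c a \<in> A" if "diag3 a b c \<in> A" for a b c
    using imageI[OF that, of "\<lambda>M. perm_E ** M ** matrix_inv perm_E"] assms(4)
    by (simp add: perm_E_conj_diag3)

  \<comment> \<open>The entry groups \<open>H\<close> and \<open>K\<close> as groups of roots of
    unity\<close>
  define H where "H = {a. \<exists>b c. diag3 a b c \<in> A}"
  \<comment> \<open>Determinant 1 forces the middle entry once the first is 1, so the third entry
    alone records such a matrix.\<close>
  define K where "K = {c. diag3 1 (inverse c) c \<in> A}"
  define m where "m = card H"
  define n where "n = card K"
  have "H \<subseteq> (\<lambda>M. M $ 1 $ 1) ` A"
    by (force simp: H_def image_iff)
  then have "finite H"
    using finite_subset assms(2) by blast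
  \<comment> \<open>Shifting diag(1, 1/c, c) twice gives diag(c, 1, 1/c), which puts
    \<open>c\<close> in first position.\<close>
  moreover have "K \<subseteq> H"
    using shift unfolding H_def K_def by blast
  ultimately have "finite K"
    by (rule finite_subset[rotated])
  have "0 \<notin> H" "1 \<in> H"
    using det one by (fastforce simp: H_def)+
  have "1 \<in> K"
    using one by (simp add: K_def)
  have "m > 0" "n > 0"
    using \<open>finite H\<close> \<open>finite K\<close> \<open>1 \<in> H\<close> \<open>1 \<in> K\<close> by (auto simp: m_def n_def card_gt_0_iff)
  have H: "H = {z. z ^ m = 1}" unfolding m_def
  proof (rule finite_mult_closed_eq_roots_unity)
    show "x * y \<in> H" if "x \<in> H" "y \<in> H" for x y
      using that mult unfolding H_def by blast
  qed (use \<open>finite H\<close> \<open>0 \<notin> H\<close> \<open>1 \<in> H\<close> in auto)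
  have K: "K = {z. z ^ n = 1}" unfolding n_def
  proof (rule finite_mult_closed_eq_roots_unity)
    show "x * y \<in> K" if "x \<in> K" "y \<in> K" for x y
      using mult[of 1 "inverse x" x 1 "inverse y" y] that by (simp add: K_def)
  qed (use \<open>finite K\<close> \<open>0 \<notin> H\<close> \<open>1 \<in> K\<close> \<open>K \<subseteq> H\<close> in auto)
  have in_H: "a \<in> H" "b \<in> H" "c \<in> H" if "diag3 a b c \<in> A" for a b c
    using that shift unfolding H_def by blast+

  define \<epsilon> :: complex where "\<epsilon> = exp (2 * of_real pi * \<i> / of_nat m)"
  define \<delta> :: complex where "\<delta> = exp (2 * of_real pi * \<i> / of_nat n)"
  define r where "r = m div n"
  have \<epsilon>_pow: "\<epsilon> ^ j = 1 \<longleftrightarrow> m dvd j" for j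
    unfolding \<epsilon>_def by (rule exp_root_unity_power_eq_1_iff[OF \<open>m > 0\<close>])
  have \<delta>_pow: "\<delta> ^ j = 1 \<longleftrightarrow> n dvd j" for j
    unfolding \<delta>_def by (rule exp_root_unity_power_eq_1_iff[OF \<open>n > 0\<close>])
  have "\<epsilon> \<in> H" "\<delta> \<in> K"
    using \<epsilon>_pow[of m] \<delta>_pow[of n] by (auto simp: H K)
  \<comment> \<open>The primitive \<open>n\<close>-th root \<delta> lies in \<open>H\<close>, so its
    \<open>m\<close>-th power is 1.\<close>
  then have "n dvd m"
    using \<open>K \<subseteq> H\<close> \<delta>_pow[of m] by (auto simp: H)
  then have mn: "m = r * n"
    by (simp add: r_def)
  with \<open>m > 0\<close> have "r > 0"
    by simp
  have \<epsilon>_r: "\<epsilon> ^ r = \<delta>"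
    using \<open>r > 0\<close> unfolding \<epsilon>_def \<delta>_def mn by (simp flip: exp_of_nat_mult)
  have "\<epsilon> \<noteq> 0"
    by (simp add: \<epsilon>_def)

  \<comment> \<open>The generators \<open>F\<close> and \<open>G\<close>\<close>
  define G where "G = diag3 1 (inverse \<delta>) \<delta>"
  have "G \<in> A"
    using \<open>\<delta> \<in> K\<close> by (simp add: G_def K_def)
  obtain b c where bc: "diag3 \<epsilon> b c \<in> A"
    using \<open>\<epsilon> \<in> H\<close> by (auto simp: H_def)
  \<comment> \<open>Cyclic shifts put \<open>b\<close> in \<open>H\<close> as well, and \<epsilon>
    generates \<open>H\<close>.\<close>
  obtain j where j: "b = \<epsilon> ^ j"
    using root_unity_eq_exp_power[OF \<open>m > 0\<close>, of b] in_H(2)[OF bc] by (auto simp: H \<epsilon>_def)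
  define k where "k = j mod r"
  define F where "F = diag3 \<epsilon> (\<epsilon> ^ k) (inverse (\<epsilon> * \<epsilon> ^ k))"
  \<comment> \<open>Multiplying by a power of \<^term>\<open>G\<close> reduces the second exponent modulo \<^term>\<open>r\<close>.\<close>
  have "F \<in> A"
  proof -
    have "\<epsilon> ^ j = \<epsilon> ^ k * \<delta> ^ (j div r)"
      unfolding k_def \<epsilon>_r[symmetric] power_mult[symmetric] power_add[symmetric] by simp
    then have 1: "b * inverse \<delta> ^ (j div r) = \<epsilon> ^ k"
      by (simp add: j \<delta>_def field_simps)
    have 2: "diag3 \<epsilon> (\<epsilon> ^ k) (c * \<delta> ^ (j div r)) \<in> A"
      using mult[OF bc pow[of 1 "inverse \<delta>" \<delta> "j div r"]] \<open>G \<in> A\<close> by (simp add: G_def flip: 1)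
    \<comment> \<open>The third entry need not be tracked: the determinant determines it.\<close>
    have "c * \<delta> ^ (j div r) = inverse (\<epsilon> * \<epsilon> ^ k)"
      using det[OF 2] by (metis inverse_unique)
    with 2 show ?thesis
      by (simp add: F_def)
  qed

  \<comment> \<open>Orders of \<open>F\<close> and \<open>G\<close> and the subgroups they
    generate\<close>
  have F_pow: "F [^]\<^bsub>?G\<^esub> i = diag3 (\<epsilon> ^ i) ((\<epsilon> ^ k) ^ i) (inverse (\<epsilon> * \<epsilon> ^ k) ^ i)" for i :: nat
    by (simp add: F_def diag3_nat_pow)
  have G_pow: "G [^]\<^bsub>?G\<^esub> i = diag3 1 (inverse (\<delta> ^ i)) (\<delta> ^ i)" for i :: nat
    by (simp add: G_def diag3_nat_pow power_inverse)
  have one_eq: "\<one>\<^bsub>?G\<^esub> = diag3 1 1 1"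
    by (simp add: SU_def mat_1_eq_diag3)
  have F_one: "F [^]\<^bsub>?G\<^esub> i = \<one>\<^bsub>?G\<^esub>" if "m dvd i" for i :: nat
  proof -
    have "(\<epsilon> ^ k) ^ i = 1"
      by (metis \<epsilon>_pow mult.commute power_mult power_one that)
    with that show ?thesis
      by (simp add: F_pow one_eq \<epsilon>_pow power_inverse power_mult_distrib)
  qed
  have ord_F: "ord F = m"
    using \<open>F \<in> A\<close> F_one by (subst ord_unique) (auto simp: F_pow one_eq \<epsilon>_pow)
  have ord_G: "ord G = n"
    using \<open>G \<in> A\<close> by (subst ord_unique) (auto simp: G_pow one_eq \<delta>_pow)
  \<comment> \<open>\<open>generate\<close> uses inverses, which depend on the carrier; they agree
    because \<open>A\<close> is a subgroup of \<open>SU3\<close>.\<close>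
  have gen: "generate ?G {X} = generate SU3 {X}" if "X \<in> A" for X
    using that group.generate_consistent[OF group_SU _ assms(1)] by simp
  \<comment> \<open>Since the order is finite, natural exponents already give the whole cyclic
    group.\<close>
  have gen_F: "generate SU3 {F} = {F [^]\<^bsub>?G\<^esub> i | i. i \<in> (UNIV::nat set)}"
    using generate_pow_nat[of F] \<open>F \<in> A\<close> ord_F \<open>m > 0\<close> by (simp add: gen)
  have gen_G: "generate SU3 {G} = {G [^]\<^bsub>?G\<^esub> i | i. i \<in> (UNIV::nat set)}"
    using generate_pow_nat[of G] \<open>G \<in> A\<close> ord_G \<open>n > 0\<close> by (simp add: gen)

  have F_iso: "SU3\<lparr>carrier := generate SU3 {F}\<rparr> \<cong> integer_mod_group m"
    using generate_singleton_iso[of F] \<open>F \<in> A\<close> by (simp add: ord_F gen)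
  have G_iso: "SU3\<lparr>carrier := generate SU3 {G}\<rparr> \<cong> integer_mod_group n"
    using generate_singleton_iso[of G] \<open>G \<in> A\<close> by (simp add: ord_G gen)

  have sub: "subgroup (generate SU3 {X}) ?G" if "X \<in> A" for X
    using generate_is_subgroup[of "{X}"] that by (simp add: gen)

  \<comment> \<open>Internal direct product decomposition\<close>
  have idp: "internal_direct_product ?G (generate SU3 {F}) (generate SU3 {G})"
    unfolding internal_direct_product_def
  proof (intro conjI)
    show "generate SU3 {F} \<lhd> ?G" "generate SU3 {G} \<lhd> ?G"
      using sub \<open>F \<in> A\<close> \<open>G \<in> A\<close> by (auto intro: subgroup_imp_normal)
    \<comment> \<open>Powers of \<open>G\<close> have first entry 1, so a common element
      \<open>F^i\<close> satisfies \<epsilon>\<open>^i = 1\<close>. Then \<open>m\<close> divides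
      \<open>i\<close>, which makes \<open>F^i\<close> trivial.\<close>
    have "X = \<one>\<^bsub>?G\<^esub>" if X: "X \<in> generate SU3 {F}" "X \<in> generate SU3 {G}" for X
    proof -
      obtain i l :: nat where i: "X = F [^]\<^bsub>?G\<^esub> i" and "X = G [^]\<^bsub>?G\<^esub> l"
        using X unfolding gen_F gen_G by blast
      then have "\<epsilon> ^ i = 1"
        by (simp add: F_pow G_pow)
      then show ?thesis
        using F_one i \<epsilon>_pow by simp
    qed
    then show "generate SU3 {F} \<inter> generate SU3 {G} = {\<one>\<^bsub>?G\<^esub>}"
      using subgroup.one_closed[OF sub[OF \<open>F \<in> A\<close>]] subgroup.one_closed[OF sub[OF \<open>G \<in> A\<close>]] by blast
    have "M \<in> generate SU3 {F} <#>\<^bsub>?G\<^esub> generate SU3 {G}" if MA: "M \<in> A" for M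
    proof -
      obtain a b c where M: "M = diag3 a b c"
        using diag[OF MA] by blast
      obtain i where i: "a = \<epsilon> ^ i"
        using root_unity_eq_exp_power[OF \<open>m > 0\<close>, of a] in_H(1) MA M by (auto simp: H \<epsilon>_def)
      \<comment> \<open>The exponent \<open>i\<close> is read off from the first entry of
        \<open>M\<close>. Dividing by \<open>F^i\<close> leaves first entry 1, so \<open>N\<close>
        is described by an element of \<open>K\<close> and is a power of \<open>G\<close>.\<close>
      define N where "N = inv\<^bsub>?G\<^esub> (F [^]\<^bsub>?G\<^esub> i) \<otimes>\<^bsub>?G\<^esub> M"
      have Fi: "F [^]\<^bsub>?G\<^esub> i \<in> carrier ?G"
        using \<open>F \<in> A\<close> by (intro nat_pow_closed) simp
      have "N \<in> A"
        using m_closed[OF inv_closed[OF Fi], of M] that by (simp add: N_def)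
      have MN: "M = F [^]\<^bsub>?G\<^esub> i \<otimes>\<^bsub>?G\<^esub> N"
        using m_assoc[OF Fi inv_closed[OF Fi], of M] r_inv[OF Fi] l_one[of M] MA by (simp add: N_def)
      obtain x y z where N: "N = diag3 x y z" "x * y * z = 1"
        using diag[OF \<open>N \<in> A\<close>] by blast
      have "x = 1"
        using MN \<open>\<epsilon> \<noteq> 0\<close> unfolding M N(1) F_pow i by (simp add: SU_def)
      then have "y = inverse z"
        using N(2) inverse_unique[of z y] by (simp add: mult.commute)
      with \<open>x = 1\<close> have N': "N = diag3 1 (inverse z) z"
        by (simp add: N(1))
      with \<open>N \<in> A\<close> have "z \<in> K"
        by (simp add: K_def)
      then obtain l where "z = \<delta> ^ l"
        using root_unity_eq_exp_power[OF \<open>n > 0\<close>, of z] by (auto simp: K \<delta>_def)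
      then have "N = G [^]\<^bsub>?G\<^esub> l"
        by (simp add: N' G_pow)
      with MN show ?thesis
        unfolding set_mult_def gen_F gen_G by blast
    qed
    moreover have "generate SU3 {F} <#>\<^bsub>?G\<^esub> generate SU3 {G} \<subseteq> A"
      using setmult_subset_G[of "generate SU3 {F}" "generate SU3 {G}"]
        subgroup.subset[OF sub[OF \<open>F \<in> A\<close>]] subgroup.subset[OF sub[OF \<open>G \<in> A\<close>]] by simp
    ultimately show "generate SU3 {F} <#>\<^bsub>?G\<^esub> generate SU3 {G} = carrier ?G"
      by auto
  qed

  \<comment> \<open>Isomorphism type of \<open>A\<close> and the required forms of \<open>F\<close>
    and \<open>G\<close>\<close>
  have "?G \<cong> integer_mod_group m \<times>\<times> integer_mod_group n"
  proof -
    have "SU3\<lparr>carrier := generate SU3 {F}\<rparr> \<times>\<times> SU3\<lparr>carrier := generate SU3 {G}\<rparr> \<cong> ?G"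
      using internal_direct_product_iso[OF idp] by simp
    moreover have "group (SU3\<lparr>carrier := generate SU3 {F}\<rparr>)" "group (SU3\<lparr>carrier := generate SU3 {G}\<rparr>)"
      using subgroup.subgroup_is_group[OF sub is_group] \<open>F \<in> A\<close> \<open>G \<in> A\<close> by auto
    ultimately show ?thesis
      using iso_trans[OF group.iso_sym[OF DirProd_group] group.DirProd_iso_trans[OF _ F_iso G_iso]]
      by blast
  qed
  moreover have "F = diag3 \<epsilon> (\<epsilon> ^ k) (\<epsilon> powi (- int k - 1))"
  proof -
    \<comment> \<open>Written as the negative of a natural number, the exponent fits the rules for
      \<open>powi\<close>.\<close>
    have "\<epsilon> powi (- int k - 1) = \<epsilon> powi (- int (Suc k))"
      by (rule arg_cong) simp
    also have "\<dots> = inverse (\<epsilon> * \<epsilon> ^ k)"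
      by (simp only: power_int_minus power_int_of_nat power_Suc)
    finally show ?thesis
      by (simp add: F_def)
  qed
  moreover have "k \<in> {0..<r}"
    using \<open>r > 0\<close> by (simp add: k_def)
  moreover have "G = diag3 1 (\<epsilon> powi (- int r)) (\<epsilon> powi (int r))"
    by (simp add: G_def power_int_minus \<epsilon>_r)
  ultimately show ?thesis
    using \<open>m > 0\<close> \<open>n > 0\<close> \<open>n dvd m\<close> \<open>F \<in> A\<close> \<open>G \<in> A\<close> F_iso G_iso idp
    unfolding Let_def
    by (intro exI[of _ m] exI[of _ n] conjI bexI[of _ F] bexI[of _ G] bexI[of _ k])
      (simp_all flip: \<epsilon>_def r_def)
qed

end
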